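(* Let $L$ be a CW complex and let $X$ and $Y$ be separable metric spaces of extension dimension at most $[L]$. If $X$ and $Y$ have isomorphic closed covers, each regular for the class of at most $[L]$-dimensional spaces, then $X$ and $Y$ are $[L]$-homotopy equivalent.
   Context: All spaces (other than $L$) are separable metric; maps are continuous. A space $Z$ is an absolute extensor for a space $W$ if each map from a closed subset of $W$ into $Z$ extends over all of $W$. A (separable metric) space $W$ has extension dimension at most $[L]$ (is at most $[L]$-dimensional) if $L$ is an absolute extensor for $W$. $AE[L]$ is the class of absolute extensors for all at most $[L]$-dimensional spaces. Convention: the empty set is counted as an absolute extensor when forming $AE[L]$ (i.e. only non-empty closed subsets are considered in the definition; for non-empty spaces this makes no difference). An $AE[L]$-cover is a cover such that the intersection of each non-empty collection of its elements belongs to $AE[L]$. A cover is locally finite dimensional if its nerve is, i.e. for each element $F$ of the cover there is a finite bound on the cardinality of finite subcollections containing $F$ that have non-empty intersection. A closed cover (all elements closed) is regular for the class of at most $[L]$-dimensional spaces if it is a locally finite, locally finite dimensional $AE[L]$-cover. A carrier is a function $C \colon \mathcal{F} \to \mathcal{G}$ from a cover $\mathcal{F}$ of a space into a collection $\mathcal{G}$ of subsets of a topological space such that for each (non-empty) $\mathcal{A} \subset \mathcal{F}$, if $\bigcap \mathcal{A} \neq \emptyset$, then $\bigcap_{A \in \mathcal{A}} C(A) \neq \emptyset$. Two covers are isomorphic if there is a carrier from one onto the other that is invertible, i.e. is bijective and its inverse is a carrier. Maps $f, g \colon X \to Y$ are $[L]$-homotopic if for each at most $[L]$-dimensional space $Z$,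 each pair $A, B$ of disjoint closed subsets of $Z$ and each map $h \colon Z \to X$, the map $f \circ h|_A \cup g \circ h|_B \colon A \cup B \to Y$ extends to a map $Z \to Y$. Spaces $X$ and $Y$ are $[L]$-homotopy equivalent if there exist maps $f \colon X \to Y$ and $g \colon Y \to X$ such that $g \circ f$ is $[L]$-homotopic to $\mathrm{id}_X$ and $f \circ g$ is $[L]$-homotopic to $\mathrm{id}_Y$. *)

theory Defs
  imports "HOL-Analysis.Analysis"
begin

section \<open>CW complexes\<close>

text \<open>The topology of \<open>Euclidean_space n\<close> lives on the sequences vanishing from index \<open>n\<close> on, so
  the ball and the sphere of every dimension are available in one type. For \<open>n = 0\<close> the ball is a
  point and its boundary is empty.\<close>

definition unit_disc :: "nat \<Rightarrow> (nat \<Rightarrow> real) set" where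
  "unit_disc n = {x \<in> topspace (Euclidean_space n). (\<Sum>i<n. (x i)\<^sup>2) \<le> 1}"

definition open_unit_disc :: "nat \<Rightarrow> (nat \<Rightarrow> real) set" where
  "open_unit_disc n = {x \<in> topspace (Euclidean_space n). (\<Sum>i<n. (x i)\<^sup>2) < 1}"

definition unit_disc_boundary :: "nat \<Rightarrow> (nat \<Rightarrow> real) set" where
  "unit_disc_boundary n = {x \<in> topspace (Euclidean_space n). (\<Sum>i<n. (x i)\<^sup>2) = 1}"

text \<open>A Hausdorff space partitioned into open cells \<open>e\<close> of dimension \<open>d e\<close> with characteristic maps
  \<open>\<Phi> e\<close>; the two last conditions are closure finiteness and the weak topology.\<close>

definition CW_structure ::
  "'c topology \<Rightarrow> 'c set set \<Rightarrow> ('c set \<Rightarrow> nat) \<Rightarrow> ('c set \<Rightarrow> (nat \<Rightarrow> real) \<Rightarrow> 'c) \<Rightarrow> bool" where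
  "CW_structure L E d \<Phi> \<longleftrightarrow>
     Hausdorff_space L \<and>
     pairwise disjnt E \<and> \<Union>E = topspace L \<and>
     (\<forall>e\<in>E. continuous_map (subtopology (Euclidean_space (d e)) (unit_disc (d e))) L (\<Phi> e) \<and>
             homeomorphic_map (subtopology (Euclidean_space (d e)) (open_unit_disc (d e)))
               (subtopology L e) (\<Phi> e)) \<and>
     (\<forall>e\<in>E. \<exists>F. finite F \<and> F \<subseteq> {e' \<in> E. d e' < d e} \<and> \<Phi> e ` unit_disc_boundary (d e) \<subseteq> \<Union>F) \<and>
     (\<forall>C \<subseteq> topspace L. (\<forall>e\<in>E. closedin L (C \<inter> L closure_of e)) \<longrightarrow> closedin L C)"

definition CW_complex :: "'c topology \<Rightarrow> bool" where
  "CW_complex L \<longleftrightarrow> (\<exists>E d \<Phi>. CW_structure L E d \<Phi>)"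

section \<open>Extension dimension and absolute extensors\<close>

definition separable_metric :: "'a topology \<Rightarrow> bool" where
  "separable_metric X \<longleftrightarrow> metrizable_space X \<and> separable_space X"

definition extends_over :: "'w topology \<Rightarrow> 'z topology \<Rightarrow> 'w set \<Rightarrow> ('w \<Rightarrow> 'z) \<Rightarrow> bool" where
  "extends_over W Z A f \<longleftrightarrow> (\<exists>g. continuous_map W Z g \<and> (\<forall>x\<in>A. g x = f x))"

definition absolute_extensor_for :: "'z topology \<Rightarrow> 'w topology \<Rightarrow> bool" where
  "absolute_extensor_for Z W \<longleftrightarrow>
     (\<forall>A f. closedin W A \<and> continuous_map (subtopology W A) Z f \<longrightarrow> extends_over W Z A f)"

definition ext_dim_le :: "'c topology \<Rightarrow> 'w topology \<Rightarrow> bool" where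
  "ext_dim_le L W \<longleftrightarrow> separable_metric W \<and> absolute_extensor_for L W"

text \<open>Below, ``for all at most \<open>[L]\<close>-dimensional spaces'' is a quantification over topologies whose
  points are reals. This loses nothing, as every separable metrizable space is homeomorphic to such
  a topology; the lemmas \<open>in_AE_extends\<close> and \<open>L_homotopic_extends\<close> give the conditions for
  test spaces of an arbitrary type. Only non-empty closed sets are used in \<open>in_AE L\<close>, so that the
  empty space satisfies it; the definition of extension dimension above has no such restriction.\<close>

definition in_AE :: "'c topology \<Rightarrow> 'z topology \<Rightarrow> bool" where
  "in_AE L Z \<longleftrightarrow>
     (\<forall>W :: real topology. ext_dim_le L W \<longrightarrow>
        (\<forall>A f. closedin W A \<and> A \<noteq> {} \<and> continuous_map (subtopology W A) Z f
           \<longrightarrow> extends_over W Z A f))"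

section \<open>Covers and carriers\<close>

definition AE_cover :: "'c topology \<Rightarrow> 'a topology \<Rightarrow> 'a set set \<Rightarrow> bool" where
  "AE_cover L X \<F> \<longleftrightarrow>
     \<Union>\<F> = topspace X \<and> (\<forall>\<A> \<subseteq> \<F>. \<A> \<noteq> {} \<longrightarrow> in_AE L (subtopology X (\<Inter>\<A>)))"

definition locally_finite_dimensional :: "'a set set \<Rightarrow> bool" where
  "locally_finite_dimensional \<F> \<longleftrightarrow>
     (\<forall>F\<in>\<F>. \<exists>N::nat. \<forall>\<A> \<subseteq> \<F>. finite \<A> \<and> F \<in> \<A> \<and> \<Inter>\<A> \<noteq> {} \<longrightarrow> card \<A> \<le> N)"

definition regular_closed_cover :: "'c topology \<Rightarrow> 'a topology \<Rightarrow> 'a set set \<Rightarrow> bool" where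
  "regular_closed_cover L X \<F> \<longleftrightarrow>
     (\<forall>F\<in>\<F>. closedin X F) \<and> locally_finite_in X \<F> \<and> locally_finite_dimensional \<F> \<and>
     AE_cover L X \<F>"

definition is_carrier :: "'a set set \<Rightarrow> 'b set set \<Rightarrow> ('a set \<Rightarrow> 'b set) \<Rightarrow> bool" where
  "is_carrier \<F> \<G> C \<longleftrightarrow>
     C \<in> \<F> \<rightarrow> \<G> \<and> (\<forall>\<A> \<subseteq> \<F>. \<A> \<noteq> {} \<and> \<Inter>\<A> \<noteq> {} \<longrightarrow> (\<Inter>A\<in>\<A>. C A) \<noteq> {})"

definition isomorphic_covers :: "'a set set \<Rightarrow> 'b set set \<Rightarrow> bool" where
  "isomorphic_covers \<F> \<G> \<longleftrightarrow>
     (\<exists>C. is_carrier \<F> \<G> C \<and> bij_betw C \<F> \<G> \<and> is_carrier \<G> \<F> (inv_into \<F> C))"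

section \<open>\<open>[L]\<close>-homotopy\<close>

text \<open>As \<open>A\<close> and \<open>B\<close> are disjoint, the \<open>if\<close> below is the map that is \<open>f \<circ> h\<close> on \<open>A\<close> and
  \<open>g \<circ> h\<close> on \<open>B\<close>.\<close>

definition L_homotopic ::
  "'c topology \<Rightarrow> 'a topology \<Rightarrow> 'b topology \<Rightarrow> ('a \<Rightarrow> 'b) \<Rightarrow> ('a \<Rightarrow> 'b) \<Rightarrow> bool" where
  "L_homotopic L X Y f g \<longleftrightarrow>
     continuous_map X Y f \<and> continuous_map X Y g \<and>
     (\<forall>Z :: real topology. ext_dim_le L Z \<longrightarrow>
        (\<forall>A B h. closedin Z A \<and> closedin Z B \<and> disjnt A B \<and> continuous_map Z X h
           \<longrightarrow> extends_over Z Y (A \<union> B) (\<lambda>z. if z \<in> A then f (h z) else g (h z))))"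

definition L_homotopy_equivalent :: "'c topology \<Rightarrow> 'a topology \<Rightarrow> 'b topology \<Rightarrow> bool" where
  "L_homotopy_equivalent L X Y \<longleftrightarrow>
     (\<exists>f g. continuous_map X Y f \<and> continuous_map Y X g \<and>
            L_homotopic L X X (g \<circ> f) id \<and> L_homotopic L Y Y (f \<circ> g) id)"

section \<open>Test spaces of arbitrary type\<close>

lemma separable_metric_lepoll_real:
  assumes "separable_metric X"
  shows "topspace X \<lesssim> (UNIV :: real set)"
proof -
  obtain M d where M: "Metric_space M d" and X: "X = Metric_space.mtopology M d"
    using assms unfolding separable_metric_def metrizable_space_def by blast
  interpret Metric_space M d by (rule M)
  obtain C where C: "countable C" "C \<subseteq> M" "mtopology closure_of C = M"
    using assms unfolding separable_metric_def separable_space_def X by auto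
  define P where "P = C \<times> (\<rat> :: real set)"
  define \<phi> where "\<phi> = (\<lambda>x. {p \<in> P. d x (fst p) < snd p})"
  have "inj_on \<phi> M"
  proof (rule inj_onI, rule ccontr)
    fix x y assume xy: "x \<in> M" "y \<in> M" "\<phi> x = \<phi> y" "x \<noteq> y"
    define r where "r = d x y / 2"
    have r: "r > 0" using xy by (simp add: r_def)
    have "x \<in> mtopology closure_of C" using C xy by simp
    then obtain c where c: "c \<in> C" "d x c < r"
      using r xy unfolding metric_closure_of by (auto simp: mball_def)
    then obtain q where q: "q \<in> \<rat>" "d x c < q" "q < r"
      using Rats_dense_in_real by blast
    have "(c, q) \<in> \<phi> x" using c q by (simp add: \<phi>_def P_def)
    then have "(c, q) \<in> \<phi> y" using xy by simp
    then have "d y c < q" by (simp add: \<phi>_def)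
    moreover have "d x y \<le> d x c + d c y" using triangle xy c C by auto
    ultimately show False using c q commute[of y c] by (simp add: r_def)
  qed
  then have "M \<lesssim> Pow P" unfolding lepoll_def \<phi>_def by blast
  moreover have "countable P" using C by (simp add: P_def countable_rat)
  then obtain k :: "'a \<times> real \<Rightarrow> nat" where "inj_on k P" by (auto simp: countable_def)
  then have "inj_on ((`) k) (Pow P)" by (rule inj_on_image_Pow)
  then have "Pow P \<lesssim> (UNIV :: nat set set)" unfolding lepoll_def by blast
  ultimately have "M \<lesssim> (UNIV :: real set)"
    using nat_sets_eqpoll_reals by (meson eqpoll_imp_lepoll lepoll_trans)
  then show ?thesis by (simp add: X)
qed

lemma separable_metric_homeomorphic_real:
  fixes X :: "'a topology"
  assumes "separable_metric X"
  obtains W :: "real topology" where "X homeomorphic_space W"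
proof -
  obtain u :: "'a \<Rightarrow> real" where u: "inj_on u (topspace X)"
    using separable_metric_lepoll_real[OF assms] by (auto simp: lepoll_def)
  define v where "v = inv_into (topspace X) u"
  define W where "W = pullback_topology (u ` topspace X) v X"
  have uv: "v (u x) = x" if "x \<in> topspace X" for x
    using that u by (simp add: v_def)
  have tW: "topspace W = u ` topspace X"
    unfolding W_def by (auto simp: topspace_pullback_topology uv)
  have "homeomorphic_maps X W u v"
    unfolding homeomorphic_maps_def
  proof (intro conjI ballI)
    show "continuous_map X W u"
      unfolding W_def
    proof (rule continuous_map_pullback')
      show "continuous_map X X (v \<circ> u)"
        by (rule continuous_map_eq[of _ _ id]) (auto simp: uv)
    qed auto
    show "continuous_map W X v"
      unfolding W_def using continuous_map_pullback[OF continuous_map_id] by (simp add: o_def id_def)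
  qed (auto simp: uv tW)
  then show thesis using that homeomorphic_space_def by blast
qed

lemma extends_over_homeomorphic:
  assumes uv: "homeomorphic_maps W W' u v" and "A \<subseteq> topspace W"
    and "extends_over W' Z (u ` A) (f \<circ> v)"
  shows "extends_over W Z A f"
proof -
  obtain g where g: "continuous_map W' Z g" "\<forall>x\<in>u ` A. g x = (f \<circ> v) x"
    using assms unfolding extends_over_def by blast
  have "continuous_map W Z (g \<circ> u)"
    using g uv continuous_map_compose unfolding homeomorphic_maps_def by blast
  moreover have "\<forall>x\<in>A. (g \<circ> u) x = f x"
    using g uv assms(2) unfolding homeomorphic_maps_def by auto
  ultimately show ?thesis unfolding extends_over_def by blast
qed

lemma homeomorphic_maps_transfer_closed:
  assumes uv: "homeomorphic_maps W W' u v" and A: "closedin W A"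
  shows "closedin W' (u ` A)"
    and "continuous_map (subtopology W A) Z f \<Longrightarrow> continuous_map (subtopology W' (u ` A)) Z (f \<circ> v)"
proof -
  have sub: "A \<subseteq> topspace W" using A closedin_subset by blast
  show "closedin W' (u ` A)"
    using A uv homeomorphic_map_closedness[of W W' u A] sub homeomorphic_maps_map by blast
  show "continuous_map (subtopology W' (u ` A)) Z (f \<circ> v)"
    if f: "continuous_map (subtopology W A) Z f"
  proof (rule continuous_map_compose[OF _ f])
    show "continuous_map (subtopology W' (u ` A)) (subtopology W A) v"
      using uv sub unfolding homeomorphic_maps_def
      by (auto simp: continuous_map_in_subtopology continuous_map_from_subtopology image_subset_iff
          subset_iff Pi_iff)
  qed
qed

lemma ext_dim_le_homeomorphic:
  assumes "W homeomorphic_space W'" "ext_dim_le L W"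
  shows "ext_dim_le L W'"
proof -
  obtain u v where uv: "homeomorphic_maps W' W u v"
    using assms homeomorphic_space_def homeomorphic_space_sym by blast
  have "absolute_extensor_for L W'"
    unfolding absolute_extensor_for_def
  proof (intro allI impI, elim conjE)
    fix A f assume A: "closedin W' A" "continuous_map (subtopology W' A) L f"
    show "extends_over W' L A f"
    proof (rule extends_over_homeomorphic[OF uv])
      show "A \<subseteq> topspace W'" using A closedin_subset by blast
      show "extends_over W L (u ` A) (f \<circ> v)"
        using homeomorphic_maps_transfer_closed[OF uv A(1)] A(2) assms(2)
        unfolding ext_dim_le_def absolute_extensor_for_def by blast
    qed
  qed
  then show ?thesis
    using assms homeomorphic_metrizable_space homeomorphic_separable_space
    unfolding ext_dim_le_def separable_metric_def by blast
qed

lemma ext_dim_le_real_model: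
  fixes W :: "'w topology"
  assumes "ext_dim_le L W"
  obtains W' :: "real topology" and u v where "ext_dim_le L W'" "homeomorphic_maps W W' u v"
proof -
  obtain W' :: "real topology" where W': "W homeomorphic_space W'"
    using assms separable_metric_homeomorphic_real unfolding ext_dim_le_def by blast
  with that ext_dim_le_homeomorphic[OF W' assms] show thesis
    unfolding homeomorphic_space_def by blast
qed

lemma in_AE_extends:
  fixes W :: "'w topology"
  assumes "in_AE L Z" "ext_dim_le L W" "closedin W A" "A \<noteq> {}" "continuous_map (subtopology W A) Z f"
  shows "extends_over W Z A f"
proof -
  obtain W' :: "real topology" and u v where W': "ext_dim_le L W'" and uv: "homeomorphic_maps W W' u v"
    using ext_dim_le_real_model[OF assms(2)] .
  show ?thesis
  proof (rule extends_over_homeomorphic[OF uv])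
    show "A \<subseteq> topspace W" using assms closedin_subset by blast
    show "extends_over W' Z (u ` A) (f \<circ> v)"
      using homeomorphic_maps_transfer_closed[OF uv assms(3)] assms W'
      unfolding in_AE_def by blast
  qed
qed

lemma L_homotopic_extends:
  fixes Z :: "'z topology"
  assumes fg: "L_homotopic L X Y f g" and Z: "ext_dim_le L Z"
    and AB: "closedin Z A" "closedin Z B" "disjnt A B" and h: "continuous_map Z X h"
  shows "extends_over Z Y (A \<union> B) (\<lambda>z. if z \<in> A then f (h z) else g (h z))"
proof -
  obtain Z' :: "real topology" and u v where Z': "ext_dim_le L Z'" and uv: "homeomorphic_maps Z Z' u v"
    using ext_dim_le_real_model[OF Z] .
  have sub: "A \<subseteq> topspace Z" "B \<subseteq> topspace Z" using AB closedin_subset by blast+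
  have vu: "v (u z) = z" if "z \<in> topspace Z" for z
    using that uv unfolding homeomorphic_maps_def by blast
  have dis: "disjnt (u ` A) (u ` B)"
    using AB sub vu unfolding disjnt_iff by (metis imageE subsetD)
  have "continuous_map Z' X (h \<circ> v)"
    using uv h continuous_map_compose unfolding homeomorphic_maps_def by blast
  then have "extends_over Z' Y (u ` A \<union> u ` B)
      (\<lambda>z. if z \<in> u ` A then f ((h \<circ> v) z) else g ((h \<circ> v) z))"
    using fg Z' dis homeomorphic_maps_transfer_closed(1)[OF uv] AB unfolding L_homotopic_def by blast
  then obtain k where k: "continuous_map Z' Y k"
    "\<forall>z \<in> u ` A \<union> u ` B. k z = (if z \<in> u ` A then f ((h \<circ> v) z) else g ((h \<circ> v) z))"
    unfolding extends_over_def by blast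
  have "k z = ((\<lambda>z. if z \<in> A then f (h z) else g (h z)) \<circ> v) z" if "z \<in> u ` (A \<union> B)" for z
  proof -
    from that obtain a where a: "z = u a" "a \<in> A \<union> B" by blast
    then have "z \<in> u ` A \<longleftrightarrow> a \<in> A" using sub vu by (metis Un_iff imageE imageI subsetD)
    moreover have "v z = a" using a sub vu by blast
    ultimately show ?thesis using k(2) that by (auto simp: image_Un)
  qed
  then have "extends_over Z' Y (u ` (A \<union> B)) ((\<lambda>z. if z \<in> A then f (h z) else g (h z)) \<circ> v)"
    using k(1) unfolding extends_over_def by blast
  then show ?thesis using extends_over_homeomorphic[OF uv] sub by blast
qed

end

theory Submission
  imports Defs
begin

text \<open>
  This is a nerve argument carried out one intersection at a time. Let \<open>\<F>\<close> be a locally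
  finite, locally finite dimensional closed cover of an at most \<open>[L]\<close>-dimensional space \<open>Z\<close>, and
  let \<open>C\<close> assign to its members subsets of a space \<open>Y\<close> whose intersections are in \<open>AE[L]\<close>,
  such that members with a common point are sent to sets with a common point. Then each partial
  map \<open>f\<close> on a closed set \<open>A\<close> with \<open>f (A \<inter> F) \<subseteq> C F\<close> for all \<open>F\<close> extends to a map
  \<open>g : Z \<rightarrow> Y\<close> with \<open>g F \<subseteq> C F\<close> for all \<open>F\<close>. The extension is built on the non-empty
  intersections of members of \<open>\<F>\<close>, smallest intersections first: when an intersection \<open>T\<close> of
  a subfamily \<open>J\<close> is reached, the map exists already on all intersections of larger subfamilies and
  on \<open>A\<close>, and it takes the part of \<open>T\<close> on which it exists into \<open>\<Inter>F\<in>J. C F\<close>; as that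
  set is in \<open>AE[L]\<close> and \<open>T\<close>, being closed in \<open>Z\<close>, is at most \<open>[L]\<close>-dimensional, the map
  extends over \<open>T\<close>. Local finite dimensionality provides the maximal subfamilies at which to
  proceed, and local finiteness makes the pasted map continuous. This is
  \<open>carried_extension_exists\<close>, and \<open>carrier_extension\<close> is its form for pullbacks of regular
  covers.

  Given isomorphic regular covers with the bijection \<open>C : \<F> \<rightarrow> \<G>\<close>, the case of empty \<open>A\<close>
  yields maps \<open>f : X \<rightarrow> Y\<close> and \<open>g : Y \<rightarrow> X\<close> with \<open>f F \<subseteq> C F\<close> and \<open>g (C F) \<subseteq> F\<close>.
  So \<open>g \<circ> f\<close> maps every \<open>F \<in> \<F>\<close> into itself, as the identity does, and two maps with this
  property are \<open>[L]\<close>-homotopic: for \<open>h : Z \<rightarrow> X\<close> the prescribed map on \<open>A \<union> B\<close> sends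
  points of \<open>h -` F\<close> into \<open>F\<close>, so it extends by \<open>carrier_extension\<close> applied to the cover of
  \<open>Z\<close> by the sets \<open>h -` F\<close>. That cover may repeat sets, which is why covers are treated as
  indexed families below.
\<close>

section \<open>Closed subspaces of at most \<open>[L]\<close>-dimensional spaces\<close>

text \<open>Separability alone is not inherited by subspaces, second countability is. In the metrizable
  case they agree: the balls of rational radius around a countable dense set form a base.\<close>

lemma separable_metric_imp_second_countable:
  assumes "separable_metric X"
  shows "second_countable X"
proof -
  obtain M d where M: "Metric_space M d" and X: "X = Metric_space.mtopology M d"
    using assms unfolding separable_metric_def metrizable_space_def by blast
  interpret Metric_space M d by (rule M)
  obtain C where C: "countable C" "C \<subseteq> M" "mtopology closure_of C = M"
    using assms unfolding separable_metric_def separable_space_def X by auto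
  define \<B> where "\<B> = (\<lambda>(c, q). mball c q) ` (C \<times> (\<rat> :: real set))"
  have "\<exists>V\<in>\<B>. x \<in> V \<and> V \<subseteq> U" if U: "openin mtopology U" "x \<in> U" for U x
  proof -
    obtain r where r: "r > 0" "mball x r \<subseteq> U" and x: "x \<in> M"
      using U unfolding openin_mtopology by blast
    have "x \<in> mtopology closure_of C" using C x by simp
    then obtain c where c: "c \<in> C" "d x c < r / 2"
      using r unfolding metric_closure_of by (force simp: mball_def dest: spec[of _ "r / 2"])
    then obtain q where q: "q \<in> \<rat>" "d x c < q" "q < r / 2"
      using Rats_dense_in_real by blast
    have cM: "c \<in> M" using c C by blast
    have "mball c q \<subseteq> mball x r"
    proof
      fix y assume y: "y \<in> mball c q"
      then have "d x y \<le> d x c + d c y" using triangle x cM by auto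
      then show "y \<in> mball x r" using y q x by auto
    qed
    moreover have "x \<in> mball c q" using x cM q commute by simp
    ultimately show ?thesis using r c q unfolding \<B>_def by blast
  qed
  moreover have "countable \<B>" unfolding \<B>_def using C by (simp add: countable_rat)
  moreover have "\<forall>V\<in>\<B>. openin mtopology V" unfolding \<B>_def by auto
  ultimately show ?thesis unfolding second_countable_def X by blast
qed

lemma separable_metric_subtopology:
  assumes "separable_metric X"
  shows "separable_metric (subtopology X S)"
proof -
  have "separable_space (subtopology X S)"
    by (intro second_countable_imp_separable_space second_countable_subtopology
        separable_metric_imp_second_countable assms)
  then show ?thesis
    using assms unfolding separable_metric_def by (simp add: metrizable_space_subtopology)
qed

lemma ext_dim_le_closed_subtopology:
  assumes W: "ext_dim_le L W" and S: "closedin W S"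
  shows "ext_dim_le L (subtopology W S)"
proof -
  have "extends_over (subtopology W S) L A f"
    if A: "closedin (subtopology W S) A"
      and f: "continuous_map (subtopology (subtopology W S) A) L f" for A f
  proof -
    have AS: "A \<subseteq> S" "closedin W A"
      using A S closedin_closed_subtopology by blast+
    then have "continuous_map (subtopology W A) L f"
      using f by (simp add: subtopology_subtopology Int_absorb1)
    then obtain g where "continuous_map W L g" "\<forall>x\<in>A. g x = f x"
      using W AS unfolding ext_dim_le_def absolute_extensor_for_def extends_over_def by blast
    then show ?thesis
      unfolding extends_over_def using continuous_map_from_subtopology by blast
  qed
  then show ?thesis
    using W separable_metric_subtopology
    unfolding ext_dim_le_def absolute_extensor_for_def by blast
qed

section \<open>Extending maps that follow a carrier\<close>

lemma closedin_locally_finite_UN: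
  assumes fin: "\<And>x. x \<in> topspace X \<Longrightarrow> \<exists>V. openin X V \<and> x \<in> V \<and> finite {i \<in> I. T i \<inter> V \<noteq> {}}"
    and clo: "\<And>i. i \<in> I \<Longrightarrow> closedin X (T i)"
  shows "closedin X (\<Union>i\<in>I. T i)"
proof (rule closedin_locally_finite_Union)
  show "locally_finite_in X (T ` I)"
    unfolding locally_finite_in_def
  proof (intro conjI ballI)
    show "\<Union>(T ` I) \<subseteq> topspace X" using clo closedin_subset by blast
    fix x assume "x \<in> topspace X"
    then obtain V where V: "openin X V" "x \<in> V" "finite {i \<in> I. T i \<inter> V \<noteq> {}}"
      using fin by blast
    have "{U \<in> T ` I. U \<inter> V \<noteq> {}} = T ` {i \<in> I. T i \<inter> V \<noteq> {}}" by blast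
    with V show "\<exists>V. openin X V \<and> x \<in> V \<and> finite {U \<in> T ` I. U \<inter> V \<noteq> {}}"
      by (intro exI[of _ V]) simp
  qed
qed (use clo in blast)

locale carrier_extension_problem =
  fixes L :: "'c topology" and Z :: "'z topology" and Y :: "'y topology"
    and I :: "'i set" and K :: "'i \<Rightarrow> 'z set" and C :: "'i \<Rightarrow> 'y set"
    and A :: "'z set" and f :: "'z \<Rightarrow> 'y"
  assumes dim: "ext_dim_le L Z"
    and closed: "i \<in> I \<Longrightarrow> closedin Z (K i)"
    and cover: "topspace Z \<subseteq> (\<Union>i\<in>I. K i)"
    and locfin: "z \<in> topspace Z \<Longrightarrow> \<exists>V. openin Z V \<and> z \<in> V \<and> finite {i \<in> I. K i \<inter> V \<noteq> {}}"
    and findim: "i \<in> I \<Longrightarrow> \<exists>N::nat. \<forall>J\<subseteq>I. finite J \<and> i \<in> J \<and> (\<Inter>j\<in>J. K j) \<noteq> {} \<longrightarrow> card J \<le> N"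
    and carries: "J \<subseteq> I \<Longrightarrow> J \<noteq> {} \<Longrightarrow> (\<Inter>j\<in>J. K j) \<noteq> {} \<Longrightarrow> topspace Y \<inter> (\<Inter>j\<in>J. C j) \<noteq> {}"
    and AE: "J \<subseteq> I \<Longrightarrow> J \<noteq> {} \<Longrightarrow> in_AE L (subtopology Y (\<Inter>j\<in>J. C j))"
    and A: "closedin Z A" and f: "continuous_map (subtopology Z A) Y f"
    and f_carried: "i \<in> I \<Longrightarrow> z \<in> A \<Longrightarrow> z \<in> K i \<Longrightarrow> f z \<in> C i"
begin

definition nerve_simplex :: "'i set \<Rightarrow> bool" where
  "nerve_simplex J \<longleftrightarrow> J \<subseteq> I \<and> J \<noteq> {} \<and> (\<Inter>j\<in>J. K j) \<noteq> {}"

text \<open>Giving the index \<open>{}\<close> to the set \<open>A\<close> lets \<open>A\<close> and the intersections of the cover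
  be pasted together as one family.\<close>

definition piece :: "'i set \<Rightarrow> 'z set" where
  "piece J = (if J = {} then A else (\<Inter>j\<in>J. K j))"

lemma piece_empty [simp]: "piece {} = A"
  by (simp add: piece_def)

lemma closedin_piece: "J \<subseteq> I \<Longrightarrow> closedin Z (piece J)"
  unfolding piece_def using A closed by (auto intro!: closedin_INT)

lemma locally_finite_pieces:
  assumes z: "z \<in> topspace Z" and S: "S \<subseteq> Pow I"
  shows "\<exists>V. openin Z V \<and> z \<in> V \<and> finite {J \<in> S. piece J \<inter> V \<noteq> {}}"
proof -
  obtain V where V: "openin Z V" "z \<in> V" "finite {i \<in> I. K i \<inter> V \<noteq> {}}"
    using locfin[OF z] by blast
  have "{J \<in> S. piece J \<inter> V \<noteq> {}} \<subseteq> Pow {i \<in> I. K i \<inter> V \<noteq> {}}"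
  proof (intro subsetI PowI)
    fix J j assume J: "J \<in> {J \<in> S. piece J \<inter> V \<noteq> {}}" and j: "j \<in> J"
    then obtain x where x: "x \<in> piece J" "x \<in> V" by blast
    have "x \<in> K j" using x j by (auto simp: piece_def split: if_splits)
    then show "j \<in> {i \<in> I. K i \<inter> V \<noteq> {}}" using J j x S by blast
  qed
  then show ?thesis using V by (meson finite_Pow_iff finite_subset)
qed

lemma simplex_finite: "nerve_simplex J \<Longrightarrow> finite J"
proof -
  assume J: "nerve_simplex J"
  then obtain z where z: "z \<in> (\<Inter>j\<in>J. K j)" by (auto simp: nerve_simplex_def)
  obtain j where "j \<in> J" "j \<in> I" using J by (auto simp: nerve_simplex_def)
  then have "z \<in> topspace Z" using z closedin_subset[OF closed] by blast
  then obtain V where "z \<in> V" "finite {i \<in> I. K i \<inter> V \<noteq> {}}" using locfin by blast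
  moreover have "J \<subseteq> {i \<in> I. K i \<inter> V \<noteq> {}}"
    using J z \<open>z \<in> V\<close> by (auto simp: nerve_simplex_def)
  ultimately show "finite J" by (rule_tac finite_subset)
qed

text \<open>The simplices that contain a fixed \<open>i \<in> J\<close> are bounded in cardinality, and one of largest
  cardinality among those outside \<open>S\<close> is maximal.\<close>

lemma maximal_simplex_outside:
  assumes "nerve_simplex J" "J \<notin> S"
  obtains J' where "nerve_simplex J'" "J' \<notin> S"
    "\<And>J''. nerve_simplex J'' \<Longrightarrow> J' \<subset> J'' \<Longrightarrow> J'' \<in> S"
proof -
  obtain i where i: "i \<in> J" "i \<in> I" using assms by (auto simp: nerve_simplex_def)
  obtain N where N: "\<And>J'. nerve_simplex J' \<Longrightarrow> i \<in> J' \<Longrightarrow> card J' \<le> N"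
    using findim[OF i(2)] simplex_finite unfolding nerve_simplex_def by metis
  define P where "P J' \<longleftrightarrow> nerve_simplex J' \<and> i \<in> J' \<and> J' \<notin> S" for J'
  have "\<exists>J'. P J' \<and> (\<forall>J''. P J'' \<longrightarrow> card J'' \<le> card J')"
  proof (rule Lattices_Big.ex_has_greatest_nat)
    show "P J" using assms i by (simp add: P_def)
    show "\<forall>J'. P J' \<longrightarrow> card J' < Suc N" using N by (auto simp: P_def le_imp_less_Suc)
  qed
  then obtain J' where J': "P J'" "\<And>J''. P J'' \<Longrightarrow> card J'' \<le> card J'" by blast
  show thesis
  proof
    show "nerve_simplex J'" "J' \<notin> S" using J' by (auto simp: P_def)
    fix J'' assume J'': "nerve_simplex J''" "J' \<subset> J''"
    then have "card J' < card J''" using simplex_finite psubset_card_mono by blast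
    then have "\<not> P J''" using J'(2) by fastforce
    then show "J'' \<in> S" using J'' J'(1) by (auto simp: P_def)
  qed
qed

text \<open>A partial solution is a set of pairs of a simplex and a map on its piece. Keeping the local
  maps apart, instead of one map on their union, makes the first two clauses conditions on one or
  two pairs only, and the third is preserved by unions; hence unions of chains of partial
  solutions are partial solutions for trivial reasons, and continuity of a pasted map is needed
  only for a single partial solution at a time. By the third clause a simplex is solved only after
  the simplices above it, so that the smallest intersections come first.\<close>

definition partial_solution :: "('i set \<times> ('z \<Rightarrow> 'y)) set \<Rightarrow> bool" where
  "partial_solution M \<longleftrightarrow>
     (\<forall>J h. (J, h) \<in> M \<longrightarrow> nerve_simplex J \<and> continuous_map (subtopology Z (piece J)) Y h \<and>
        (\<forall>i\<in>I. \<forall>z \<in> piece J \<inter> K i. h z \<in> C i) \<and> (\<forall>z \<in> A \<inter> piece J. h z = f z)) \<and>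
     (\<forall>J h J' h'. (J, h) \<in> M \<and> (J', h') \<in> M \<longrightarrow> (\<forall>z \<in> piece J \<inter> piece J'. h z = h' z)) \<and>
     (\<forall>J h J'. (J, h) \<in> M \<and> nerve_simplex J' \<and> J \<subseteq> J' \<longrightarrow> J' \<in> fst ` M)"

lemma partial_solutionD:
  assumes "partial_solution M" "(J, h) \<in> M"
  shows "nerve_simplex J" "continuous_map (subtopology Z (piece J)) Y h"
    "\<And>i z. i \<in> I \<Longrightarrow> z \<in> piece J \<Longrightarrow> z \<in> K i \<Longrightarrow> h z \<in> C i"
    "\<And>z. z \<in> A \<Longrightarrow> z \<in> piece J \<Longrightarrow> h z = f z"
    "\<And>J' h' z. (J', h') \<in> M \<Longrightarrow> z \<in> piece J \<Longrightarrow> z \<in> piece J' \<Longrightarrow> h z = h' z"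
    "\<And>J'. nerve_simplex J' \<Longrightarrow> J \<subseteq> J' \<Longrightarrow> J' \<in> fst ` M"
proof -
  note M = assms(1)[unfolded partial_solution_def]
  note local = conjunct1[OF M, rule_format, OF assms(2)]
  show "nerve_simplex J" "continuous_map (subtopology Z (piece J)) Y h" using local by blast+
  show "h z \<in> C i" if "i \<in> I" "z \<in> piece J" "z \<in> K i" for i z using local that by blast
  show "h z = f z" if "z \<in> A" "z \<in> piece J" for z using local that by blast
  show "h z = h' z" if "(J', h') \<in> M" "z \<in> piece J" "z \<in> piece J'" for J' h' z
    using conjunct1[OF conjunct2[OF M], rule_format, of J h J' h'] assms(2) that by blast
  show "J' \<in> fst ` M" if "nerve_simplex J'" "J \<subseteq> J'" for J'
    using conjunct2[OF conjunct2[OF M], rule_format, of J h J'] assms(2) that by blast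
qed

lemma partial_solutionI:
  assumes "\<And>J h. (J, h) \<in> M \<Longrightarrow> nerve_simplex J"
    and "\<And>J h. (J, h) \<in> M \<Longrightarrow> continuous_map (subtopology Z (piece J)) Y h"
    and "\<And>J h i z. (J, h) \<in> M \<Longrightarrow> i \<in> I \<Longrightarrow> z \<in> piece J \<Longrightarrow> z \<in> K i \<Longrightarrow> h z \<in> C i"
    and "\<And>J h z. (J, h) \<in> M \<Longrightarrow> z \<in> A \<Longrightarrow> z \<in> piece J \<Longrightarrow> h z = f z"
    and "\<And>J h J' h' z. (J, h) \<in> M \<Longrightarrow> (J', h') \<in> M \<Longrightarrow> z \<in> piece J \<Longrightarrow> z \<in> piece J' \<Longrightarrow> h z = h' z"
    and "\<And>J h J'. (J, h) \<in> M \<Longrightarrow> nerve_simplex J' \<Longrightarrow> J \<subseteq> J' \<Longrightarrow> J' \<in> fst ` M"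
  shows "partial_solution M"
  unfolding partial_solution_def
  by (intro conjI allI impI ballI; (elim conjE IntE)?; rule assms; assumption)

lemma maximal_partial_solution:
  obtains M where "partial_solution M" "\<And>M'. partial_solution M' \<Longrightarrow> M \<subseteq> M' \<Longrightarrow> M' = M"
proof -
  have "partial_solution (\<Union>\<C>)" if \<C>: "subset.chain {M. partial_solution M} \<C>" for \<C>
  proof -
    have sol: "partial_solution M" if "M \<in> \<C>" for M
      using \<C> that unfolding subset.chain_def by blast
    have common: "\<exists>M\<in>\<C>. p \<in> M \<and> q \<in> M" if pq: "p \<in> \<Union>\<C>" "q \<in> \<Union>\<C>" for p q
    proof -
      obtain M N where "M \<in> \<C>" "p \<in> M" "N \<in> \<C>" "q \<in> N" using pq by blast
      moreover have "M \<subseteq> N \<or> N \<subseteq> M"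
        using \<C> \<open>M \<in> \<C>\<close> \<open>N \<in> \<C>\<close> unfolding subset_chain_def by blast
      ultimately show ?thesis by blast
    qed
    show ?thesis
    proof (rule partial_solutionI)
      fix J h J' h' z
      assume "(J, h) \<in> \<Union>\<C>" "(J', h') \<in> \<Union>\<C>" "z \<in> piece J" "z \<in> piece J'"
      then obtain M where "M \<in> \<C>" "(J, h) \<in> M" "(J', h') \<in> M" using common by metis
      then show "h z = h' z"
        using partial_solutionD(5)[OF sol] \<open>z \<in> piece J\<close> \<open>z \<in> piece J'\<close> by blast
    next
      fix J h J' assume "(J, h) \<in> \<Union>\<C>" "nerve_simplex J'" "J \<subseteq> J'"
      then obtain M where "M \<in> \<C>" "(J, h) \<in> M" by blast
      then have "J' \<in> fst ` M"
        using partial_solutionD(6)[OF sol] \<open>nerve_simplex J'\<close> \<open>J \<subseteq> J'\<close> by blast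
      then show "J' \<in> fst ` \<Union>\<C>" using \<open>M \<in> \<C>\<close> by blast
    qed (use partial_solutionD(1-4)[OF sol] in blast)+
  qed
  then have "\<exists>M\<in>{M. partial_solution M}. \<forall>X\<in>{M. partial_solution M}. M \<subseteq> X \<longrightarrow> X = M"
    by (intro subset_Zorn') simp
  then show thesis using that by blast
qed

definition solved_part :: "('i set \<times> ('z \<Rightarrow> 'y)) set \<Rightarrow> 'z set" where
  "solved_part M = (\<Union>J\<in>insert {} (fst ` M). piece J)"

lemma solved_indices:
  assumes "partial_solution M"
  shows "insert {} (fst ` M) \<subseteq> Pow I"
proof -
  have "fst p \<subseteq> I" if "p \<in> M" for p
    using partial_solutionD(1)[OF assms, of "fst p" "snd p"] that by (simp add: nerve_simplex_def)
  then show ?thesis by blast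
qed

lemma closedin_solved_part:
  assumes "partial_solution M"
  shows "closedin Z (solved_part M)"
  unfolding solved_part_def
proof (rule closedin_locally_finite_UN)
  show "closedin Z (piece J)" if "J \<in> insert {} (fst ` M)" for J
    using closedin_piece that solved_indices[OF assms] by blast
qed (rule locally_finite_pieces[OF _ solved_indices[OF assms]])

lemma paste_partial_solution:
  assumes M: "partial_solution M"
  obtains g where "continuous_map (subtopology Z (solved_part M)) Y g"
    "\<And>z. z \<in> A \<Longrightarrow> g z = f z"
    "\<And>J h z. (J, h) \<in> M \<Longrightarrow> z \<in> piece J \<Longrightarrow> g z = h z"
    "\<And>z i. z \<in> solved_part M \<Longrightarrow> i \<in> I \<Longrightarrow> z \<in> K i \<Longrightarrow> g z \<in> C i"
proof -
  let ?S = "insert {} (fst ` M)" and ?D = "solved_part M"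
  define k where "k J = (if J = {} then f else SOME h. (J, h) \<in> M)" for J
  have ne: "J \<noteq> {}" if "(J, h) \<in> M" for J h
    using partial_solutionD(1)[OF M that] by (simp add: nerve_simplex_def)
  have k: "(J, k J) \<in> M" if "J \<in> fst ` M" for J
  proof -
    obtain h where h: "(J, h) \<in> M" using \<open>J \<in> fst ` M\<close> by auto
    then have "k J = (SOME h. (J, h) \<in> M)" using ne by (simp add: k_def)
    then show ?thesis using someI[of "\<lambda>h. (J, h) \<in> M", OF h] by simp
  qed
  note SI = solved_indices[OF M]
  have pD: "piece J \<subseteq> ?D" if "J \<in> ?S" for J
    using that by (auto simp: solved_part_def)
  have Z: "?D \<subseteq> topspace Z" using closedin_solved_part[OF M] closedin_subset by blast
  have k_cont: "continuous_map (subtopology Z (piece J)) Y (k J)" if "J \<in> ?S" for J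
  proof (cases "J = {}")
    case False
    with that have "(J, k J) \<in> M" using k by blast
    then show ?thesis by (rule partial_solutionD(2)[OF M])
  qed (simp add: k_def f)
  have k_A: "k J z = f z" if "J \<in> ?S" "z \<in> piece J" "z \<in> A" for J z
  proof (cases "J = {}")
    case False
    with that have "(J, k J) \<in> M" using k by blast
    then show ?thesis using partial_solutionD(4)[OF M] that by blast
  qed (simp add: k_def)
  have agree: "k J z = k J' z" if "J \<in> ?S" "J' \<in> ?S" "z \<in> piece J" "z \<in> piece J'" for J J' z
  proof (cases "J = {} \<or> J' = {}")
    case True
    then have "z \<in> A" using that by auto
    then show ?thesis using k_A[OF that(1,3)] k_A[OF that(2,4)] by simp
  next
    case False
    with that have "(J, k J) \<in> M" "(J', k J') \<in> M" using k by blast+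
    then show ?thesis using partial_solutionD(5)[OF M] that by blast
  qed
  define g where "g z = k (SOME J. J \<in> ?S \<and> z \<in> piece J) z" for z
  have g_k: "g z = k J z" if "J \<in> ?S" "z \<in> piece J" for J z
  proof -
    have "\<exists>J. J \<in> ?S \<and> z \<in> piece J" using that by blast
    from someI_ex[OF this] show ?thesis unfolding g_def using agree that by blast
  qed
  have g: "continuous_map (subtopology Z ?D) Y g"
  proof (rule pasting_lemma_locally_finite[of "subtopology Z ?D" ?S piece Y k])
    show "\<exists>V. openin (subtopology Z ?D) V \<and> z \<in> V \<and> finite {J \<in> ?S. piece J \<inter> V \<noteq> {}}"
      if "z \<in> topspace (subtopology Z ?D)" for z
    proof -
      have z: "z \<in> topspace Z" "z \<in> ?D" using that by auto
      obtain V where V: "openin Z V" "z \<in> V" "finite {J \<in> ?S. piece J \<inter> V \<noteq> {}}"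
        using locally_finite_pieces[OF z(1) SI] by blast
      have "finite {J \<in> ?S. piece J \<inter> (V \<inter> ?D) \<noteq> {}}"
        by (rule finite_subset[OF _ V(3)]) blast
      moreover have "openin (subtopology Z ?D) (V \<inter> ?D)"
        using V(1) by (auto simp: openin_subtopology)
      ultimately show ?thesis using V(2) z(2) by (intro exI[of _ "V \<inter> ?D"]) simp
    qed
    show "closedin (subtopology Z ?D) (piece J)" if "J \<in> ?S" for J
      using that pD[OF that] SI closedin_piece[of J] by (intro closedin_subset_topspace) auto
    show "continuous_map (subtopology (subtopology Z ?D) (piece J)) Y (k J)" if "J \<in> ?S" for J
      using k_cont[OF that] pD[OF that] by (simp add: subtopology_subtopology Int_absorb1)
    show "k J z = k J' z"
      if "J \<in> ?S" "J' \<in> ?S" "z \<in> topspace (subtopology Z ?D) \<inter> piece J \<inter> piece J'" for J J' z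
      using that agree by blast
    show "\<exists>J. J \<in> ?S \<and> z \<in> piece J \<and> g z = k J z"
      if z: "z \<in> topspace (subtopology Z ?D)" for z
    proof -
      obtain J where "J \<in> ?S" "z \<in> piece J"
        using z unfolding topspace_subtopology solved_part_def by blast
      then show ?thesis using g_k by blast
    qed
  qed
  have g_M: "g z = h z" if "(J, h) \<in> M" "z \<in> piece J" for J h z
    using that g_k[of J z] k[of J] partial_solutionD(5)[OF M] by (metis fst_conv image_eqI insertCI)
  have g_A: "g z = f z" if "z \<in> A" for z
    using g_k[of "{}" z] that by (simp add: k_def)
  show thesis
  proof
    fix z i assume z: "z \<in> ?D" "i \<in> I" "z \<in> K i"
    then consider "z \<in> A" | J h where "(J, h) \<in> M" "z \<in> piece J"
      by (auto simp: solved_part_def)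
    then show "g z \<in> C i"
    proof cases
      case 1
      then show ?thesis using g_A f_carried z by simp
    next
      case 2
      then show ?thesis using g_M partial_solutionD(3)[OF M 2(1)] z by simp
    qed
  qed (use g g_A g_M in auto)
qed

text \<open>At a simplex \<open>J\<close> all of whose proper cofaces are solved, a point of the piece of \<open>J\<close> that
  lies in a further member \<open>K i\<close> is in the piece of \<open>insert i J\<close> and so in the solved part.
  Hence a map from the piece of \<open>J\<close> into \<open>\<Inter>j\<in>J. C j\<close> follows the carrier as soon as it extends
  the map that is given on the solved part.\<close>

lemma extend_partial_solution:
  assumes M: "partial_solution M" and J: "nerve_simplex J"
    and cofaces: "\<And>J'. nerve_simplex J' \<Longrightarrow> J \<subset> J' \<Longrightarrow> J' \<in> fst ` M"
  obtains h where "partial_solution (insert (J, h) M)"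
proof -
  let ?D = "solved_part M" and ?P = "piece J" and ?C = "\<Inter>j\<in>J. C j"
  obtain g where g: "continuous_map (subtopology Z ?D) Y g"
    "\<And>z. z \<in> A \<Longrightarrow> g z = f z"
    "\<And>J h z. (J, h) \<in> M \<Longrightarrow> z \<in> piece J \<Longrightarrow> g z = h z"
    "\<And>z i. z \<in> ?D \<Longrightarrow> i \<in> I \<Longrightarrow> z \<in> K i \<Longrightarrow> g z \<in> C i"
    by (rule paste_partial_solution[OF M]) (rule that)
  have JI: "J \<subseteq> I" "J \<noteq> {}" using J by (auto simp: nerve_simplex_def)
  have P: "?P = (\<Inter>j\<in>J. K j)" using JI by (simp add: piece_def)
  have clo: "closedin Z ?P" "closedin Z ?D"
    using closedin_piece[OF JI(1)] closedin_solved_part[OF M] .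
  have "\<exists>h. continuous_map (subtopology Z ?P) (subtopology Y ?C) h \<and> (\<forall>z \<in> ?D \<inter> ?P. h z = g z)"
  proof (cases "?D \<inter> ?P = {}")
    case True
    \<comment> \<open>Nothing is prescribed on the piece, and \<open>AE[L]\<close> also holds for the empty set, so it is the
      carrier condition that provides a value.\<close>
    have "topspace Y \<inter> ?C \<noteq> {}"
      using carries[OF JI] J by (simp add: nerve_simplex_def)
    then obtain c where "c \<in> topspace Y \<inter> ?C" by blast
    then have "continuous_map (subtopology Z ?P) (subtopology Y ?C) (\<lambda>_. c)"
      by (simp add: continuous_map_in_subtopology image_subset_iff)
    with True show ?thesis by blast
  next
    case False
    have "extends_over (subtopology Z ?P) (subtopology Y ?C) (?D \<inter> ?P) g"
    proof (rule in_AE_extends[OF AE[OF JI] ext_dim_le_closed_subtopology[OF dim clo(1)]])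
      show "closedin (subtopology Z ?P) (?D \<inter> ?P)"
        using clo by (intro closedin_subset_topspace closedin_Int) auto
      have "continuous_map (subtopology (subtopology Z ?D) ?P) Y g"
        using g(1) continuous_map_from_subtopology by blast
      moreover have "subtopology (subtopology Z ?P) (?D \<inter> ?P) = subtopology (subtopology Z ?D) ?P"
        by (simp add: subtopology_subtopology Int_ac)
      moreover have "g z \<in> ?C" if "z \<in> ?D \<inter> ?P" for z
        using that g(4) JI P by auto
      ultimately show "continuous_map (subtopology (subtopology Z ?P) (?D \<inter> ?P)) (subtopology Y ?C) g"
        by (auto simp: continuous_map_in_subtopology)
    qed (rule False)
    then show ?thesis unfolding extends_over_def by blast
  qed
  then obtain h where h: "continuous_map (subtopology Z ?P) (subtopology Y ?C) h"
    "\<And>z. z \<in> ?D \<Longrightarrow> z \<in> ?P \<Longrightarrow> h z = g z" by blast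
  have h_C: "h z \<in> ?C" if "z \<in> ?P" for z
  proof -
    have "z \<in> topspace (subtopology Z ?P)" using that clo closedin_subset by fastforce
    then show ?thesis using h(1) by (auto simp: continuous_map_def)
  qed
  have h_carried: "h z \<in> C i" if z: "z \<in> ?P" "i \<in> I" "z \<in> K i" for z i
  proof (cases "i \<in> J")
    case True
    then show ?thesis using h_C z by blast
  next
    case False
    have zi: "z \<in> piece (insert i J)" using z P by (simp add: piece_def)
    have "nerve_simplex (insert i J)" using z P JI by (auto simp: nerve_simplex_def)
    then have "insert i J \<in> fst ` M" using cofaces False by blast
    then have "z \<in> ?D" using zi unfolding solved_part_def by blast
    then show ?thesis using h(2) g(4) z by metis
  qed
  have h_M: "h z = h' z" if "(J', h') \<in> M" "z \<in> piece J'" "z \<in> ?P" for J' h' z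
  proof -
    have "z \<in> ?D" using that unfolding solved_part_def by force
    then show ?thesis using h(2) g(3) that by metis
  qed
  have "partial_solution (insert (J, h) M)"
  proof (rule partial_solutionI)
    fix J' h' J'' h'' z
    assume "(J', h') \<in> insert (J, h) M" "(J'', h'') \<in> insert (J, h) M" "z \<in> piece J'" "z \<in> piece J''"
    then show "h' z = h'' z"
      using h_M partial_solutionD(5)[OF M] by (metis insertE prod.inject)
  next
    fix J' h' z assume "(J', h') \<in> insert (J, h) M" "z \<in> A" "z \<in> piece J'"
    moreover have "z \<in> ?D" using \<open>z \<in> A\<close> by (simp add: solved_part_def)
    ultimately show "h' z = f z" using h(2) g(2) partial_solutionD(4)[OF M] by auto
  next
    fix J' h' J'' assume "(J', h') \<in> insert (J, h) M" "nerve_simplex J''" "J' \<subseteq> J''"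
    then show "J'' \<in> fst ` insert (J, h) M"
      using cofaces partial_solutionD(6)[OF M] by (metis Pair_inject fst_conv image_insert insertE insertI1 insertI2 psubsetI)
  next
    fix J' h' assume "(J', h') \<in> insert (J, h) M"
    then show "continuous_map (subtopology Z (piece J')) Y h'"
      using h(1) partial_solutionD(2)[OF M] by (auto simp: continuous_map_in_subtopology)
  qed (use J h_carried partial_solutionD(1,3)[OF M] in auto)
  then show thesis by (rule that)
qed

lemma carried_extension_exists:
  obtains g where "continuous_map Z Y g" "\<And>z. z \<in> A \<Longrightarrow> g z = f z"
    "\<And>i z. i \<in> I \<Longrightarrow> z \<in> K i \<Longrightarrow> g z \<in> C i"
proof -
  obtain M where M: "partial_solution M"
    and max: "\<And>M'. partial_solution M' \<Longrightarrow> M \<subseteq> M' \<Longrightarrow> M' = M"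
    using maximal_partial_solution by blast
  have all: "J \<in> fst ` M" if "nerve_simplex J" for J
  proof (rule ccontr)
    assume "J \<notin> fst ` M"
    then obtain J' where J': "nerve_simplex J'" "J' \<notin> fst ` M"
      "\<And>J''. nerve_simplex J'' \<Longrightarrow> J' \<subset> J'' \<Longrightarrow> J'' \<in> fst ` M"
      using maximal_simplex_outside[OF \<open>nerve_simplex J\<close>] by metis
    obtain h where h: "partial_solution (insert (J', h) M)"
      using extend_partial_solution[OF M J'(1) J'(3)] by blast
    have "insert (J', h) M = M" using max[OF h] by blast
    then have "(J', h) \<in> M" by blast
    then show False using J'(2) by force
  qed
  have KD: "K i \<subseteq> solved_part M" if "i \<in> I" for i
  proof
    fix z assume z: "z \<in> K i"
    then have "nerve_simplex {i}" using that by (auto simp: nerve_simplex_def)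
    then have "{i} \<in> fst ` M" by (rule all)
    moreover have "z \<in> piece {i}" using z by (simp add: piece_def)
    ultimately show "z \<in> solved_part M" unfolding solved_part_def by blast
  qed
  have D: "solved_part M = topspace Z"
    using KD cover closedin_subset[OF closedin_solved_part[OF M]] by blast
  obtain g where g: "continuous_map (subtopology Z (solved_part M)) Y g"
    "\<And>z. z \<in> A \<Longrightarrow> g z = f z"
    "\<And>z i. z \<in> solved_part M \<Longrightarrow> i \<in> I \<Longrightarrow> z \<in> K i \<Longrightarrow> g z \<in> C i"
    by (rule paste_partial_solution[OF M]) (rule that)
  show thesis
  proof
    show "continuous_map Z Y g" using g(1) D by simp
  qed (use g KD in blast)+
qed

end

section \<open>Regular covers\<close>

lemma regular_closed_coverD:
  assumes "regular_closed_cover L X \<F>"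
  shows "F \<in> \<F> \<Longrightarrow> closedin X F" "locally_finite_in X \<F>"
    "F \<in> \<F> \<Longrightarrow> \<exists>N::nat. \<forall>J\<subseteq>\<F>. finite J \<and> F \<in> J \<and> \<Inter>J \<noteq> {} \<longrightarrow> card J \<le> N"
    "\<Union>\<F> = topspace X" "J \<subseteq> \<F> \<Longrightarrow> J \<noteq> {} \<Longrightarrow> in_AE L (subtopology X (\<Inter>J))"
  using assms
  by (simp_all add: regular_closed_cover_def AE_cover_def locally_finite_dimensional_def)

text \<open>The cover of \<open>Z\<close> is the pullback of the regular cover \<open>\<F>\<close> of \<open>X\<close> along \<open>p\<close>,
  indexed by \<open>\<F>\<close>.\<close>

lemma carrier_extension:
  fixes Z :: "'z topology"
  assumes dim: "ext_dim_le L Z" and p: "continuous_map Z X p"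
    and \<F>: "regular_closed_cover L X \<F>" and \<G>: "regular_closed_cover L Y \<G>"
    and C: "is_carrier \<F> \<G> C"
    and A: "closedin Z A" and f: "continuous_map (subtopology Z A) Y f"
    and f_carried: "\<And>F z. F \<in> \<F> \<Longrightarrow> z \<in> A \<Longrightarrow> p z \<in> F \<Longrightarrow> f z \<in> C F"
  obtains g where "continuous_map Z Y g" "\<And>z. z \<in> A \<Longrightarrow> g z = f z"
    "\<And>F z. F \<in> \<F> \<Longrightarrow> z \<in> topspace Z \<Longrightarrow> p z \<in> F \<Longrightarrow> g z \<in> C F"
proof -
  define K where "K F = {z \<in> topspace Z. p z \<in> F}" for F
  have pZ: "p z \<in> topspace X" if "z \<in> topspace Z" for z
    using p that by (auto simp: continuous_map_def)
  have C_in: "C F \<in> \<G>" if "F \<in> \<F>" for F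
    using C that by (auto simp: is_carrier_def)
  have img: "p z \<in> \<Inter>J" if "z \<in> (\<Inter>F\<in>J. K F)" for J z
    using that by (auto simp: K_def)
  interpret carrier_extension_problem L Z Y \<F> K C A f
  proof
    show "closedin Z (K F)" if "F \<in> \<F>" for F
      unfolding K_def
      by (rule closedin_continuous_map_preimage[OF p regular_closed_coverD(1)[OF \<F> that]])
    show "topspace Z \<subseteq> (\<Union>F\<in>\<F>. K F)"
      using pZ regular_closed_coverD(4)[OF \<F>] unfolding K_def by blast
    show "\<exists>V. openin Z V \<and> z \<in> V \<and> finite {F \<in> \<F>. K F \<inter> V \<noteq> {}}" if z: "z \<in> topspace Z" for z
    proof -
      have "\<exists>V. openin X V \<and> p z \<in> V \<and> finite {F \<in> \<F>. F \<inter> V \<noteq> {}}"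
        using regular_closed_coverD(2)[OF \<F>] pZ[OF z] by (simp add: locally_finite_in_def)
      then obtain V where V: "openin X V" "p z \<in> V" "finite {F \<in> \<F>. F \<inter> V \<noteq> {}}" by blast
      show ?thesis
      proof (intro exI conjI)
        show "openin Z {w \<in> topspace Z. p w \<in> V}"
          using openin_continuous_map_preimage[OF p V(1)] .
        show "finite {F \<in> \<F>. K F \<inter> {w \<in> topspace Z. p w \<in> V} \<noteq> {}}"
          by (rule finite_subset[OF _ V(3)]) (auto simp: K_def)
      qed (use z V in simp)
    qed
    show "\<exists>N::nat. \<forall>J\<subseteq>\<F>. finite J \<and> F \<in> J \<and> (\<Inter>j\<in>J. K j) \<noteq> {} \<longrightarrow> card J \<le> N" if F: "F \<in> \<F>" for F
    proof -
      obtain N :: nat where "\<forall>J\<subseteq>\<F>. finite J \<and> F \<in> J \<and> \<Inter>J \<noteq> {} \<longrightarrow> card J \<le> N"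
        using regular_closed_coverD(3)[OF \<F> F] by blast
      moreover have "\<Inter>J \<noteq> {}" if "(\<Inter>j\<in>J. K j) \<noteq> {}" for J using that img by blast
      ultimately show ?thesis by (intro exI[of _ N]) simp
    qed
    show "topspace Y \<inter> (\<Inter>F\<in>J. C F) \<noteq> {}" if J: "J \<subseteq> \<F>" "J \<noteq> {}" "(\<Inter>F\<in>J. K F) \<noteq> {}" for J
    proof -
      have "\<Inter>J \<noteq> {}" using J(3) img by blast
      then have ne: "(\<Inter>F\<in>J. C F) \<noteq> {}" using C J unfolding is_carrier_def by blast
      obtain F where "F \<in> J" using J by blast
      then have "C F \<subseteq> topspace Y"
        using C_in J regular_closed_coverD(4)[OF \<G>] by blast
      then show ?thesis using ne \<open>F \<in> J\<close> by blast
    qed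
    show "in_AE L (subtopology Y (\<Inter>F\<in>J. C F))" if J: "J \<subseteq> \<F>" "J \<noteq> {}" for J
    proof -
      have "C ` J \<subseteq> \<G>" "C ` J \<noteq> {}" using C_in J by blast+
      then show ?thesis by (rule regular_closed_coverD(5)[OF \<G>])
    qed
    show "f z \<in> C F" if "F \<in> \<F>" "z \<in> A" "z \<in> K F" for F z
      using f_carried that by (simp add: K_def)
  qed (fact dim A f)+
  show thesis
  proof (rule carried_extension_exists)
    fix g assume g: "continuous_map Z Y g" "\<And>z. z \<in> A \<Longrightarrow> g z = f z"
      "\<And>F z. F \<in> \<F> \<Longrightarrow> z \<in> K F \<Longrightarrow> g z \<in> C F"
    then show thesis by (intro that[of g]) (simp_all add: K_def)
  qed
qed

corollary carrier_selection:
  assumes "ext_dim_le L X" "regular_closed_cover L X \<F>" "regular_closed_cover L Y \<G>"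
    and "is_carrier \<F> \<G> C"
  obtains g where "continuous_map X Y g" "\<And>F x. F \<in> \<F> \<Longrightarrow> x \<in> F \<Longrightarrow> g x \<in> C F"
proof (rule carrier_extension[OF assms(1) continuous_map_id assms(2-4) closedin_empty])
  fix g assume g: "continuous_map X Y g"
    "\<And>F z. F \<in> \<F> \<Longrightarrow> z \<in> topspace X \<Longrightarrow> id z \<in> F \<Longrightarrow> g z \<in> C F"
  have "F \<subseteq> topspace X" if "F \<in> \<F>" for F
    using that regular_closed_coverD(4)[OF assms(2)] by blast
  then show thesis using g by (intro that[of g]) auto
qed (auto simp: continuous_map_on_empty)

text \<open>The analogue of the contiguity of simplicial maps: both maps follow the identity carrier of the
  cover, so they agree up to \<open>[L]\<close>-homotopy.\<close>

lemma L_homotopic_if_carried_by_identity: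
  assumes \<F>: "regular_closed_cover L X \<F>"
    and k: "continuous_map X X k" "\<And>F x. F \<in> \<F> \<Longrightarrow> x \<in> F \<Longrightarrow> k x \<in> F"
    and l: "continuous_map X X l" "\<And>F x. F \<in> \<F> \<Longrightarrow> x \<in> F \<Longrightarrow> l x \<in> F"
  shows "L_homotopic L X X k l"
  unfolding L_homotopic_def
proof (intro conjI allI impI k(1) l(1), elim conjE)
  fix Z :: "real topology" and A B h
  assume Z: "ext_dim_le L Z" and AB: "closedin Z A" "closedin Z B" "disjnt A B"
    and h: "continuous_map Z X h"
  let ?f = "\<lambda>z. if z \<in> A then k (h z) else l (h z)"
  have id: "is_carrier \<F> \<F> (\<lambda>F. F)" by (auto simp: is_carrier_def)
  have f: "continuous_map (subtopology Z (A \<union> B)) X ?f"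
  proof (rule pasting_lemma_closed[of "UNIV :: bool set" _ "\<lambda>b. if b then A else B" _
        "\<lambda>b. if b then k \<circ> h else l \<circ> h"])
    fix b :: bool
    show "closedin (subtopology Z (A \<union> B)) (if b then A else B)"
      using AB by (intro closedin_subset_topspace) auto
    show "continuous_map (subtopology (subtopology Z (A \<union> B)) (if b then A else B)) X
        (if b then k \<circ> h else l \<circ> h)"
      using continuous_map_compose[OF h k(1)] continuous_map_compose[OF h l(1)]
      by (simp add: continuous_map_from_subtopology)
  next
    fix b c z
    assume "z \<in> topspace (subtopology Z (A \<union> B)) \<inter> (if b then A else B) \<inter> (if c then A else B)"
    then show "(if b then k \<circ> h else l \<circ> h) z = (if c then k \<circ> h else l \<circ> h) z"
      using AB(3) by (auto simp: disjnt_iff split: if_splits)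
  next
    fix z assume z: "z \<in> topspace (subtopology Z (A \<union> B))"
    show "\<exists>b. b \<in> UNIV \<and> z \<in> (if b then A else B) \<and> ?f z = (if b then k \<circ> h else l \<circ> h) z"
      by (rule exI[of _ "z \<in> A"]) (use z in auto)
  qed simp
  have "?f z \<in> F" if "F \<in> \<F>" "h z \<in> F" for F z
    using that k(2) l(2) by simp
  then obtain g where "continuous_map Z X g" "\<And>z. z \<in> A \<union> B \<Longrightarrow> g z = ?f z"
    using carrier_extension[OF Z h \<F> \<F> id closedin_Un[OF AB(1,2)] f] by metis
  then show "extends_over Z X (A \<union> B) ?f" unfolding extends_over_def by blast
qed

theorem theorem3p6:
  fixes L :: "'c topology" and X :: "'a topology" and Y :: "'b topology"
    and \<F> :: "'a set set" and \<G> :: "'b set set"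
  assumes "CW_complex L"
    and "ext_dim_le L X" and "ext_dim_le L Y"
    and "regular_closed_cover L X \<F>" and "regular_closed_cover L Y \<G>"
    and "isomorphic_covers \<F> \<G>"
  shows "L_homotopy_equivalent L X Y"
proof -
  note X = assms(2,4) and Y = assms(3,5)
  obtain C where C: "is_carrier \<F> \<G> C" "bij_betw C \<F> \<G>" "is_carrier \<G> \<F> (inv_into \<F> C)"
    using assms(6) unfolding isomorphic_covers_def by blast
  let ?D = "inv_into \<F> C"
  obtain f where f: "continuous_map X Y f" "\<And>F x. F \<in> \<F> \<Longrightarrow> x \<in> F \<Longrightarrow> f x \<in> C F"
    using carrier_selection[OF X Y(2) C(1)] by metis
  obtain g where g: "continuous_map Y X g" "\<And>G y. G \<in> \<G> \<Longrightarrow> y \<in> G \<Longrightarrow> g y \<in> ?D G"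
    using carrier_selection[OF Y X(2) C(3)] by metis
  have CF: "C F \<in> \<G>" "?D (C F) = F" if "F \<in> \<F>" for F
    using that C(2) by (auto simp: bij_betw_def)
  have DG: "?D G \<in> \<F>" "C (?D G) = G" if "G \<in> \<G>" for G
    using that C(2) by (auto simp: bij_betw_def inv_into_into f_inv_into_f)
  have "L_homotopic L X X (g \<circ> f) id"
  proof (rule L_homotopic_if_carried_by_identity[OF X(2)])
    show "(g \<circ> f) x \<in> F" if "F \<in> \<F>" "x \<in> F" for F x
      using g(2)[OF CF(1) f(2)] CF(2) that by fastforce
  qed (use continuous_map_compose[OF f(1) g(1)] in auto)
  moreover have "L_homotopic L Y Y (f \<circ> g) id"
  proof (rule L_homotopic_if_carried_by_identity[OF Y(2)])
    show "(f \<circ> g) y \<in> G" if "G \<in> \<G>" "y \<in> G" for G y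
      using f(2)[OF DG(1) g(2)] DG(2) that by fastforce
  qed (use continuous_map_compose[OF g(1) f(1)] in auto)
  ultimately show ?thesis
    using f(1) g(1) unfolding L_homotopy_equivalent_def by blast
qed

end
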